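(* Let $\mathcal{C}$ be a Frobenius extriangulated category and let $\mathcal{X}\subseteq\mathcal{C}$ be a rigid functorially finite subcategory such that $\mathcal{X}^{\perp_1}={}^{\perp_1}\mathcal{X}$. Then the cluster-tilting subcategories of the extriangulated category $\mathcal{X}^{\perp_1}$ are precisely those cluster-tilting subcategories $\mathcal{T}\subseteq\mathcal{C}$ such that $\mathcal{X}\subseteq\mathcal{T}$.
   Context: Let $\mathbb{K}$ be a field. An extriangulated category (Nakaoka--Palu) $(\mathcal{C},\mathbb{E}_{\mathcal{C}},\mathfrak{s})$ consists of a $\mathbb{K}$-linear additive category, a $\mathbb{K}$-bilinear bifunctor $\mathbb{E}_{\mathcal{C}}\colon\mathcal{C}^{\mathrm{op}}\times\mathcal{C}\to\{\mathbb{K}\text{-modules}\}$, and an additive realisation $\mathfrak{s}$ sending $\delta\in\mathbb{E}_{\mathcal{C}}(C,A)$ to an equivalence class of sequences $A\to B\to C$ (conflations; first maps are inflations, second maps deflations), satisfying (ET3), (ET3)$^{\mathrm{op}}$, (ET4), (ET4)$^{\mathrm{op}}$. Extension-closed full subcategories inherit an extriangulated structure by restriction of $\mathbb{E}_{\mathcal C}$ and $\mathfrak{s}$. $\mathcal{C}$ is Frobenius if it has enough projectives (objects with the lifting property for deflations) and enough injectives (extension property for inflations) and the two classes coincide. Subcategories are full. $\mathcal{X}^{\perp_1}=\{Y\in\mathcal C:\mathbb{E}_{\mathcal{C}}(X,Y)=0\ \forall X\in\mathcal{X}\}$ and ${}^{\perp_1}\mathcal{X}=\{Y\in\mathcal C:\mathbb{E}_{\mathcal{C}}(Y,X)=0\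 \forall X\in\mathcal{X}\}$; both are extension-closed in $\mathcal{C}$. $\mathcal{X}$ is rigid if $\mathcal{X}\subseteq\mathcal{X}^{\perp_1}$, and functorially finite if every object of the ambient category has a left and a right $\mathcal{X}$-approximation. A subcategory $\mathcal{T}$ of an extriangulated category is cluster-tilting if it is functorially finite in it and ${}^{\perp_1}\mathcal{T}=\mathcal{T}=\mathcal{T}^{\perp_1}$, the perpendicular categories being computed in that ambient category (so, for $\mathcal{T}\subseteq\mathcal{X}^{\perp_1}$, the perpendicular categories in $\mathcal{X}^{\perp_1}$ are the intersections of those in $\mathcal{C}$ with $\mathcal{X}^{\perp_1}$). *)

theory Defs
  imports "HOL-Algebra.Module"
begin

(* Hom-sets are K-modules in the sense of HOL-Algebra; the ring multiplication and unit fields of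
   these records are never used.  Composition is written g \<bullet> f for "first f, then g".
   Composition, and the two actions on extensions below, take no objects as arguments;
   every category has this form once each arrow is tagged with its domain and codomain. *)
record ('o, 'm, 'k) cat_data =
  Obj :: "'o set"
  Hom :: "'o \<Rightarrow> 'o \<Rightarrow> ('k, 'm) module"
  Idm :: "'o \<Rightarrow> 'm"
  Cmp :: "'m \<Rightarrow> 'm \<Rightarrow> 'm" (infixl \<open>\<bullet>\<index>\<close> 70)

definition bilinear_map ::
  "('k, 'r) ring_scheme \<Rightarrow> ('k, 'a) module \<Rightarrow> ('k, 'b) module \<Rightarrow> ('k, 'c) module
    \<Rightarrow> ('a \<Rightarrow> 'b \<Rightarrow> 'c) \<Rightarrow> bool" where
  "bilinear_map K M N P f \<longleftrightarrow>
     (\<forall>x\<in>carrier M. \<forall>y\<in>carrier N. f x y \<in> carrier P) \<and>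
     (\<forall>x\<in>carrier M. \<forall>x'\<in>carrier M. \<forall>y\<in>carrier N. f (x \<oplus>\<^bsub>M\<^esub> x') y = f x y \<oplus>\<^bsub>P\<^esub> f x' y) \<and>
     (\<forall>x\<in>carrier M. \<forall>y\<in>carrier N. \<forall>y'\<in>carrier N. f x (y \<oplus>\<^bsub>N\<^esub> y') = f x y \<oplus>\<^bsub>P\<^esub> f x y') \<and>
     (\<forall>r\<in>carrier K. \<forall>x\<in>carrier M. \<forall>y\<in>carrier N. f (r \<odot>\<^bsub>M\<^esub> x) y = r \<odot>\<^bsub>P\<^esub> f x y) \<and>
     (\<forall>r\<in>carrier K. \<forall>x\<in>carrier M. \<forall>y\<in>carrier N. f x (r \<odot>\<^bsub>N\<^esub> y) = r \<odot>\<^bsub>P\<^esub> f x y)"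

locale linear_category = field K
  for K :: "('k, 'r) ring_scheme" and C :: "('o, 'm, 'k, 'z) cat_data_scheme" (structure) +
  assumes Hom_module: "\<lbrakk>A \<in> Obj C; B \<in> Obj C\<rbrakk> \<Longrightarrow> module K (Hom C A B)"
    and Id_Hom: "A \<in> Obj C \<Longrightarrow> Idm C A \<in> carrier (Hom C A A)"
    and Cmp_bilinear: "\<lbrakk>A \<in> Obj C; B \<in> Obj C; D \<in> Obj C\<rbrakk> \<Longrightarrow>
      bilinear_map K (Hom C B D) (Hom C A B) (Hom C A D) (\<lambda>g f. g \<bullet> f)"
    and Id_left: "\<lbrakk>A \<in> Obj C; B \<in> Obj C; f \<in> carrier (Hom C A B)\<rbrakk> \<Longrightarrow> Idm C B \<bullet> f = f"
    and Id_right: "\<lbrakk>A \<in> Obj C; B \<in> Obj C; f \<in> carrier (Hom C A B)\<rbrakk> \<Longrightarrow> f \<bullet> Idm C A = f"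
    and Cmp_assoc: "\<lbrakk>A \<in> Obj C; B \<in> Obj C; D \<in> Obj C; E \<in> Obj C;
      f \<in> carrier (Hom C A B); g \<in> carrier (Hom C B D); h \<in> carrier (Hom C D E)\<rbrakk> \<Longrightarrow>
      h \<bullet> (g \<bullet> f) = (h \<bullet> g) \<bullet> f"

definition zero_object :: "('o, 'm, 'k, 'z) cat_data_scheme \<Rightarrow> 'o \<Rightarrow> bool" where
  "zero_object C Z \<longleftrightarrow> Z \<in> Obj C \<and>
     (\<forall>A\<in>Obj C. carrier (Hom C A Z) = {\<zero>\<^bsub>Hom C A Z\<^esub>} \<and> carrier (Hom C Z A) = {\<zero>\<^bsub>Hom C Z A\<^esub>})"

definition biproduct ::
  "('o, 'm, 'k, 'z) cat_data_scheme \<Rightarrow> 'o \<Rightarrow> 'o \<Rightarrow> 'o \<Rightarrow> 'm \<Rightarrow> 'm \<Rightarrow> 'm \<Rightarrow> 'm \<Rightarrow> bool" where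
  "biproduct C A B S i j p q \<longleftrightarrow>
     S \<in> Obj C \<and>
     i \<in> carrier (Hom C A S) \<and> j \<in> carrier (Hom C B S) \<and>
     p \<in> carrier (Hom C S A) \<and> q \<in> carrier (Hom C S B) \<and>
     p \<bullet>\<^bsub>C\<^esub> i = Idm C A \<and> q \<bullet>\<^bsub>C\<^esub> j = Idm C B \<and>
     q \<bullet>\<^bsub>C\<^esub> i = \<zero>\<^bsub>Hom C A B\<^esub> \<and> p \<bullet>\<^bsub>C\<^esub> j = \<zero>\<^bsub>Hom C B A\<^esub> \<and>
     (i \<bullet>\<^bsub>C\<^esub> p) \<oplus>\<^bsub>Hom C S S\<^esub> (j \<bullet>\<^bsub>C\<^esub> q) = Idm C S"

locale additive_category = linear_category +
  assumes ex_zero_object: "\<exists>Z. zero_object C Z"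
    and ex_biproduct: "\<lbrakk>A \<in> Obj C; B \<in> Obj C\<rbrakk> \<Longrightarrow> \<exists>S i j p q. biproduct C A B S i j p q"

definition iso_mor :: "('o, 'm, 'k, 'z) cat_data_scheme \<Rightarrow> 'o \<Rightarrow> 'o \<Rightarrow> 'm \<Rightarrow> bool" where
  "iso_mor C A B f \<longleftrightarrow> f \<in> carrier (Hom C A B) \<and>
     (\<exists>g\<in>carrier (Hom C B A). g \<bullet>\<^bsub>C\<^esub> f = Idm C A \<and> f \<bullet>\<^bsub>C\<^esub> g = Idm C B)"

(* A sequence A -x-> B -y-> D with fixed ends A and D is the triple (x, B, y). *)
definition seqs :: "('o, 'm, 'k, 'z) cat_data_scheme \<Rightarrow> 'o \<Rightarrow> 'o \<Rightarrow> ('m \<times> 'o \<times> 'm) set" where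
  "seqs C A D = {(x, B, y). B \<in> Obj C \<and> x \<in> carrier (Hom C A B) \<and> y \<in> carrier (Hom C B D)}"

definition seq_equiv ::
  "('o, 'm, 'k, 'z) cat_data_scheme \<Rightarrow> 'o \<Rightarrow> 'o \<Rightarrow> ('m \<times> 'o \<times> 'm) rel" where
  "seq_equiv C A D = {((x, B, y), (x', B', y')).
     (x, B, y) \<in> seqs C A D \<and> (x', B', y') \<in> seqs C A D \<and>
     (\<exists>b. iso_mor C B B' b \<and> b \<bullet>\<^bsub>C\<^esub> x = x' \<and> y' \<bullet>\<^bsub>C\<^esub> b = y)}"

(* Ext C D A is the module E(D, A); push C a \<delta> is a_*\<delta>, pull C c \<delta> is c^*\<delta>, and
   realisation C D A \<delta> is the equivalence class s(\<delta>) of sequences A -> B -> D. *)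
record ('o, 'm, 'k, 'e) extri_data = "('o, 'm, 'k) cat_data" +
  Ext  :: "'o \<Rightarrow> 'o \<Rightarrow> ('k, 'e) module"
  push :: "'m \<Rightarrow> 'e \<Rightarrow> 'e"
  pull :: "'m \<Rightarrow> 'e \<Rightarrow> 'e"
  realisation :: "'o \<Rightarrow> 'o \<Rightarrow> 'e \<Rightarrow> ('m \<times> 'o \<times> 'm) set"

(* \<delta> \<in> E(D, A) and A -x-> B -y-> D realises \<delta> *)
definition realises ::
  "('o, 'm, 'k, 'e, 'z) extri_data_scheme \<Rightarrow> 'o \<Rightarrow> 'm \<Rightarrow> 'o \<Rightarrow> 'm \<Rightarrow> 'o \<Rightarrow> 'e \<Rightarrow> bool" where
  "realises C A x B y D \<delta> \<longleftrightarrow>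
     A \<in> Obj C \<and> D \<in> Obj C \<and> \<delta> \<in> carrier (Ext C D A) \<and> (x, B, y) \<in> realisation C D A \<delta>"

definition conflation ::
  "('o, 'm, 'k, 'e, 'z) extri_data_scheme \<Rightarrow> 'o \<Rightarrow> 'm \<Rightarrow> 'o \<Rightarrow> 'm \<Rightarrow> 'o \<Rightarrow> bool" where
  "conflation C A x B y D \<longleftrightarrow> (\<exists>\<delta>. realises C A x B y D \<delta>)"

definition inflation ::
  "('o, 'm, 'k, 'e, 'z) extri_data_scheme \<Rightarrow> 'o \<Rightarrow> 'o \<Rightarrow> 'm \<Rightarrow> bool" where
  "inflation C A B x \<longleftrightarrow> (\<exists>y D. conflation C A x B y D)"

definition deflation ::
  "('o, 'm, 'k, 'e, 'z) extri_data_scheme \<Rightarrow> 'o \<Rightarrow> 'o \<Rightarrow> 'm \<Rightarrow> bool" where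
  "deflation C B D y \<longleftrightarrow> (\<exists>A x. conflation C A x B y D)"

(* The axioms of Nakaoka and Palu.  In real_sum, the element of E(D \<oplus> D', A \<oplus> A') on the right
   is \<delta> \<oplus> \<delta>', whose components in E(D, A), E(D, A'), E(D', A), E(D', A') are \<delta>, 0, 0, \<delta>'. *)
locale extriangulated_category =
  additive_category K C
  for K :: "('k, 'r) ring_scheme" and C :: "('o, 'm, 'k, 'e, 'z) extri_data_scheme" (structure) +
  assumes Ext_module: "\<lbrakk>A \<in> Obj C; D \<in> Obj C\<rbrakk> \<Longrightarrow> module K (Ext C D A)"
    and push_bilinear: "\<lbrakk>A \<in> Obj C; A' \<in> Obj C; D \<in> Obj C\<rbrakk> \<Longrightarrow>
      bilinear_map K (Hom C A A') (Ext C D A) (Ext C D A') (push C)"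
    and pull_bilinear: "\<lbrakk>A \<in> Obj C; D \<in> Obj C; D' \<in> Obj C\<rbrakk> \<Longrightarrow>
      bilinear_map K (Hom C D' D) (Ext C D A) (Ext C D' A) (pull C)"
    and push_Id: "\<lbrakk>A \<in> Obj C; D \<in> Obj C; \<delta> \<in> carrier (Ext C D A)\<rbrakk> \<Longrightarrow> push C (Idm C A) \<delta> = \<delta>"
    and pull_Id: "\<lbrakk>A \<in> Obj C; D \<in> Obj C; \<delta> \<in> carrier (Ext C D A)\<rbrakk> \<Longrightarrow> pull C (Idm C D) \<delta> = \<delta>"
    and push_Cmp: "\<lbrakk>A \<in> Obj C; A' \<in> Obj C; A'' \<in> Obj C; D \<in> Obj C; \<delta> \<in> carrier (Ext C D A);
      a \<in> carrier (Hom C A A'); a' \<in> carrier (Hom C A' A'')\<rbrakk> \<Longrightarrow>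
      push C (a' \<bullet> a) \<delta> = push C a' (push C a \<delta>)"
    and pull_Cmp: "\<lbrakk>A \<in> Obj C; D \<in> Obj C; D' \<in> Obj C; D'' \<in> Obj C; \<delta> \<in> carrier (Ext C D A);
      c \<in> carrier (Hom C D' D); c' \<in> carrier (Hom C D'' D')\<rbrakk> \<Longrightarrow>
      pull C (c \<bullet> c') \<delta> = pull C c' (pull C c \<delta>)"
    and push_pull: "\<lbrakk>A \<in> Obj C; A' \<in> Obj C; D \<in> Obj C; D' \<in> Obj C; \<delta> \<in> carrier (Ext C D A);
      a \<in> carrier (Hom C A A'); c \<in> carrier (Hom C D' D)\<rbrakk> \<Longrightarrow>
      push C a (pull C c \<delta>) = pull C c (push C a \<delta>)"
    and real_class: "\<lbrakk>A \<in> Obj C; D \<in> Obj C; \<delta> \<in> carrier (Ext C D A)\<rbrakk> \<Longrightarrow>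
      realisation C D A \<delta> \<in> seqs C A D // seq_equiv C A D"
    and real_morphism: "\<lbrakk>realises C A x B y D \<delta>; realises C A' x' B' y' D' \<delta>';
      a \<in> carrier (Hom C A A'); c \<in> carrier (Hom C D D'); push C a \<delta> = pull C c \<delta>'\<rbrakk> \<Longrightarrow>
      \<exists>b\<in>carrier (Hom C B B'). b \<bullet> x = x' \<bullet> a \<and> y' \<bullet> b = c \<bullet> y"
    and real_zero: "\<lbrakk>A \<in> Obj C; D \<in> Obj C; biproduct C A D S i j p q\<rbrakk> \<Longrightarrow>
      realises C A i S q D \<zero>\<^bsub>Ext C D A\<^esub>"
    and real_sum: "\<lbrakk>realises C A x B y D \<delta>; realises C A' x' B' y' D' \<delta>';
      biproduct C A A' SA iA jA pA qA; biproduct C B B' SB iB jB pB qB;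
      biproduct C D D' SD iD jD pD qD\<rbrakk> \<Longrightarrow>
      realises C
        SA (iB \<bullet> x \<bullet> pA \<oplus>\<^bsub>Hom C SA SB\<^esub> jB \<bullet> x' \<bullet> qA)
        SB (iD \<bullet> y \<bullet> pB \<oplus>\<^bsub>Hom C SB SD\<^esub> jD \<bullet> y' \<bullet> qB)
        SD (push C iA (pull C pD \<delta>) \<oplus>\<^bsub>Ext C SD SA\<^esub> push C jA (pull C qD \<delta>'))"
    and ET3: "\<lbrakk>realises C A x B y D \<delta>; realises C A' x' B' y' D' \<delta>';
      a \<in> carrier (Hom C A A'); b \<in> carrier (Hom C B B'); b \<bullet> x = x' \<bullet> a\<rbrakk> \<Longrightarrow>
      \<exists>c\<in>carrier (Hom C D D'). c \<bullet> y = y' \<bullet> b \<and> push C a \<delta> = pull C c \<delta>'"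
    and ET3_op: "\<lbrakk>realises C A x B y D \<delta>; realises C A' x' B' y' D' \<delta>';
      b \<in> carrier (Hom C B B'); c \<in> carrier (Hom C D D'); c \<bullet> y = y' \<bullet> b\<rbrakk> \<Longrightarrow>
      \<exists>a\<in>carrier (Hom C A A'). b \<bullet> x = x' \<bullet> a \<and> push C a \<delta> = pull C c \<delta>'"
    and ET4: "\<lbrakk>realises C A f B f' D \<delta>; realises C B g G g' F \<delta>'\<rbrakk> \<Longrightarrow>
      \<exists>E h' d e \<delta>''.
        realises C A (g \<bullet> f) G h' E \<delta>'' \<and>
        realises C D d E e F (push C f' \<delta>') \<and>
        h' \<bullet> g = d \<bullet> f' \<and> e \<bullet> h' = g' \<and>
        pull C d \<delta>'' = \<delta> \<and> push C f \<delta>'' = pull C e \<delta>'"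
    and ET4_op: "\<lbrakk>realises C D f' A f B \<delta>; realises C F g' B g G \<delta>'\<rbrakk> \<Longrightarrow>
      \<exists>E h' d e \<delta>''.
        realises C E h' A (g \<bullet> f) G \<delta>'' \<and>
        realises C D d E e F (pull C g' \<delta>) \<and>
        h' \<bullet> d = f' \<and> f \<bullet> h' = g' \<bullet> e \<and>
        push C e \<delta>'' = \<delta>' \<and> push C d \<delta> = pull C g \<delta>''"

definition projective :: "('o, 'm, 'k, 'e, 'z) extri_data_scheme \<Rightarrow> 'o \<Rightarrow> bool" where
  "projective C P \<longleftrightarrow> P \<in> Obj C \<and>
     (\<forall>B D y. deflation C B D y \<longrightarrow>
       (\<forall>c\<in>carrier (Hom C P D). \<exists>b\<in>carrier (Hom C P B). y \<bullet>\<^bsub>C\<^esub> b = c))"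

definition injective :: "('o, 'm, 'k, 'e, 'z) extri_data_scheme \<Rightarrow> 'o \<Rightarrow> bool" where
  "injective C I \<longleftrightarrow> I \<in> Obj C \<and>
     (\<forall>A B x. inflation C A B x \<longrightarrow>
       (\<forall>a\<in>carrier (Hom C A I). \<exists>b\<in>carrier (Hom C B I). b \<bullet>\<^bsub>C\<^esub> x = a))"

locale frobenius_extriangulated_category = extriangulated_category +
  assumes enough_projectives: "D \<in> Obj C \<Longrightarrow> \<exists>P y. projective C P \<and> deflation C P D y"
    and enough_injectives: "A \<in> Obj C \<Longrightarrow> \<exists>I x. injective C I \<and> inflation C A I x"
    and projective_iff_injective: "projective C P \<longleftrightarrow> injective C P"

(* A full subcategory is given by its set of objects.  No closure under isomorphisms, direct sums
   or direct summands is assumed. *)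

(* The structure inherited by a full subcategory: Hom, Ext and the two actions are unchanged on
   objects of S; it is extriangulated when S is extension-closed in C. *)
definition full_sub ::
  "('o, 'm, 'k, 'e, 'z) extri_data_scheme \<Rightarrow> 'o set \<Rightarrow> ('o, 'm, 'k, 'e, 'z) extri_data_scheme" where
  "full_sub C S = C\<lparr>Obj := S, realisation := (\<lambda>D A \<delta>. {(x, B, y). (x, B, y) \<in> realisation C D A \<delta> \<and> B \<in> S})\<rparr>"

definition right_perp :: "('o, 'm, 'k, 'e, 'z) extri_data_scheme \<Rightarrow> 'o set \<Rightarrow> 'o set" where
  "right_perp C X = {Y \<in> Obj C. \<forall>A\<in>X. carrier (Ext C A Y) = {\<zero>\<^bsub>Ext C A Y\<^esub>}}"

definition left_perp :: "('o, 'm, 'k, 'e, 'z) extri_data_scheme \<Rightarrow> 'o set \<Rightarrow> 'o set" where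
  "left_perp C X = {Y \<in> Obj C. \<forall>A\<in>X. carrier (Ext C Y A) = {\<zero>\<^bsub>Ext C Y A\<^esub>}}"

definition rigid :: "('o, 'm, 'k, 'e, 'z) extri_data_scheme \<Rightarrow> 'o set \<Rightarrow> bool" where
  "rigid C X \<longleftrightarrow> X \<subseteq> right_perp C X"

definition left_approx ::
  "('o, 'm, 'k, 'z) cat_data_scheme \<Rightarrow> 'o set \<Rightarrow> 'o \<Rightarrow> 'o \<Rightarrow> 'm \<Rightarrow> bool" where
  "left_approx C X A B f \<longleftrightarrow> B \<in> X \<and> f \<in> carrier (Hom C A B) \<and>
     (\<forall>B'\<in>X. \<forall>g\<in>carrier (Hom C A B'). \<exists>h\<in>carrier (Hom C B B'). h \<bullet>\<^bsub>C\<^esub> f = g)"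

definition right_approx ::
  "('o, 'm, 'k, 'z) cat_data_scheme \<Rightarrow> 'o set \<Rightarrow> 'o \<Rightarrow> 'o \<Rightarrow> 'm \<Rightarrow> bool" where
  "right_approx C X A B f \<longleftrightarrow> B \<in> X \<and> f \<in> carrier (Hom C B A) \<and>
     (\<forall>B'\<in>X. \<forall>g\<in>carrier (Hom C B' A). \<exists>h\<in>carrier (Hom C B' B). f \<bullet>\<^bsub>C\<^esub> h = g)"

definition functorially_finite :: "('o, 'm, 'k, 'z) cat_data_scheme \<Rightarrow> 'o set \<Rightarrow> bool" where
  "functorially_finite C X \<longleftrightarrow> X \<subseteq> Obj C \<and>
     (\<forall>A\<in>Obj C. (\<exists>B f. left_approx C X A B f) \<and> (\<exists>B f. right_approx C X A B f))"

definition cluster_tilting :: "('o, 'm, 'k, 'e, 'z) extri_data_scheme \<Rightarrow> 'o set \<Rightarrow> bool" where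
  "cluster_tilting C T \<longleftrightarrow>
     functorially_finite C T \<and> left_perp C T = T \<and> T = right_perp C T"

end

theory Submission
  imports Defs
begin

text \<open>
  The heart of the matter is that \<open>\<Y> = \<X>\<^sup>\<bottom> = \<^sup>\<bottom>\<X>\<close> is functorially finite in \<open>\<C>\<close>; approximations in
  \<open>\<T>\<close> are then obtained by composing with those of \<open>\<Y>\<close>. For a right approximation of \<open>A\<close>, take a
  conflation \<open>\<Omega>A \<rightarrow> P \<rightarrow> A\<close> with \<open>P\<close> projective and push it out along a left \<open>\<X>\<close>-approximation
  \<open>\<Omega>A \<rightarrow> X\<close>, which gives \<open>X \<rightarrow> B \<rightarrow> A\<close>. Rigidity of \<open>\<X>\<close> and the approximation property give
  \<open>\<E>(B, \<X>) = 0\<close>, so \<open>B \<in> \<Y>\<close>, and \<open>B \<rightarrow> A\<close> is a right \<open>\<Y>\<close>-approximation because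
  \<open>\<E>(\<Y>, X) = 0\<close>. Left approximations are dual.
\<close>

section \<open>Exact sequences of extension modules\<close>

lemma bilinear_map_closed:
  "\<lbrakk>bilinear_map K M N P f; x \<in> carrier M; y \<in> carrier N\<rbrakk> \<Longrightarrow> f x y \<in> carrier P"
  unfolding bilinear_map_def by blast

lemma bilinear_map_zero_right:
  assumes f: "bilinear_map K M N P f" and N: "module K N" and P: "module K P"
    and x: "x \<in> carrier M"
  shows "f x \<zero>\<^bsub>N\<^esub> = \<zero>\<^bsub>P\<^esub>"
proof -
  interpret N: module K N by (rule N)
  interpret P: module K P by (rule P)
  have c: "f x \<zero>\<^bsub>N\<^esub> \<in> carrier P"
    by (rule bilinear_map_closed[OF f x N.zero_closed])
  have "f x (\<zero>\<^bsub>N\<^esub> \<oplus>\<^bsub>N\<^esub> \<zero>\<^bsub>N\<^esub>) = f x \<zero>\<^bsub>N\<^esub> \<oplus>\<^bsub>P\<^esub> f x \<zero>\<^bsub>N\<^esub>"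
    using f x N.zero_closed unfolding bilinear_map_def by blast
  then have "f x \<zero>\<^bsub>N\<^esub> \<oplus>\<^bsub>P\<^esub> f x \<zero>\<^bsub>N\<^esub> = f x \<zero>\<^bsub>N\<^esub>" by simp
  then show ?thesis using c P.add.r_cancel_one by blast
qed

section \<open>Zero morphisms and biproducts with a zero object\<close>

context linear_category
begin

lemma zero_Hom: "\<lbrakk>A \<in> Obj C; B \<in> Obj C\<rbrakk> \<Longrightarrow> \<zero>\<^bsub>Hom C A B\<^esub> \<in> carrier (Hom C A B)"
  using Hom_module[of A B] abelian_groupE(2) module.axioms(2) by blast

lemma Cmp_closed:
  "\<lbrakk>A \<in> Obj C; B \<in> Obj C; D \<in> Obj C; f \<in> carrier (Hom C A B); g \<in> carrier (Hom C B D)\<rbrakk>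
    \<Longrightarrow> g \<bullet> f \<in> carrier (Hom C A D)"
  using bilinear_map_closed[OF Cmp_bilinear] by blast

lemma Cmp_zero:
  assumes "A \<in> Obj C" "B \<in> Obj C" "D \<in> Obj C" "g \<in> carrier (Hom C B D)"
  shows "g \<bullet> \<zero>\<^bsub>Hom C A B\<^esub> = \<zero>\<^bsub>Hom C A D\<^esub>"
  using bilinear_map_zero_right[OF Cmp_bilinear] Hom_module assms by blast

text \<open>Together with its mirror image, this feeds \<open>real_zero\<close>: an identity then
  becomes a deflation, respectively an inflation, in a split conflation whose other end is a zero
  object.\<close>

lemma biproduct_zero_left:
  assumes Z: "zero_object C Z" and B: "B \<in> Obj C"
  shows "biproduct C Z B B \<zero>\<^bsub>Hom C Z B\<^esub> (Idm C B) \<zero>\<^bsub>Hom C B Z\<^esub> (Idm C B)"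
proof -
  have ZO: "Z \<in> Obj C" using Z unfolding zero_object_def by blast
  interpret H: module K "Hom C B B" using Hom_module B by blast
  have "Idm C Z = \<zero>\<^bsub>Hom C Z Z\<^esub>"
    using Id_Hom[OF ZO] Z ZO unfolding zero_object_def by blast
  then show ?thesis
    unfolding biproduct_def
    using B ZO Id_Hom[OF B] zero_Hom[of Z B] zero_Hom[of B Z] Cmp_zero[of Z B Z] Cmp_zero[of B Z B]
      Id_left[of Z B] Id_right[of B Z] Id_left[of B B] by simp
qed

lemma biproduct_zero_right:
  assumes Z: "zero_object C Z" and B: "B \<in> Obj C"
  shows "biproduct C B Z B (Idm C B) \<zero>\<^bsub>Hom C Z B\<^esub> (Idm C B) \<zero>\<^bsub>Hom C B Z\<^esub>"
proof -
  have ZO: "Z \<in> Obj C" using Z unfolding zero_object_def by blast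
  interpret H: module K "Hom C B B" using Hom_module B by blast
  have "Idm C Z = \<zero>\<^bsub>Hom C Z Z\<^esub>"
    using Id_Hom[OF ZO] Z ZO unfolding zero_object_def by blast
  then show ?thesis
    unfolding biproduct_def
    using B ZO Id_Hom[OF B] zero_Hom[of Z B] zero_Hom[of B Z] Cmp_zero[of Z B Z] Cmp_zero[of B Z B]
      Id_left[of Z B] Id_right[of B Z] Id_left[of B B] by simp
qed

lemma seq_equiv_refl:
  assumes s: "s \<in> seqs C A D" and A: "A \<in> Obj C" and D: "D \<in> Obj C"
  shows "(s, s) \<in> seq_equiv C A D"
proof -
  obtain x B y where xy: "s = (x, B, y)" by (metis prod_cases3)
  then have B: "B \<in> Obj C" and h: "x \<in> carrier (Hom C A B)" "y \<in> carrier (Hom C B D)"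
    using s unfolding seqs_def by auto
  have "iso_mor C B B (Idm C B)"
    unfolding iso_mor_def using Id_Hom[OF B] Id_left[OF B B] by blast
  moreover have "Idm C B \<bullet> x = x" "y \<bullet> Idm C B = y"
    using Id_left[OF A B h(1)] Id_right[OF B D h(2)] .
  ultimately show ?thesis using s xy unfolding seq_equiv_def by blast
qed

end

section \<open>Realisations, trivial conflations and exactness\<close>

context extriangulated_category
begin

lemma realises_objects:
  assumes "realises C A x B y D \<delta>"
  shows "A \<in> Obj C" "B \<in> Obj C" "D \<in> Obj C" "x \<in> carrier (Hom C A B)"
    "y \<in> carrier (Hom C B D)" "\<delta> \<in> carrier (Ext C D A)"
proof -
  show A: "A \<in> Obj C" and D: "D \<in> Obj C" and d: "\<delta> \<in> carrier (Ext C D A)"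
    using assms unfolding realises_def by auto
  have "(x, B, y) \<in> realisation C D A \<delta>" using assms unfolding realises_def by auto
  then have "(x, B, y) \<in> seqs C A D"
    using real_class[OF A D d] unfolding quotient_def seq_equiv_def by auto
  then show "B \<in> Obj C" "x \<in> carrier (Hom C A B)" "y \<in> carrier (Hom C B D)"
    unfolding seqs_def by auto
qed

text \<open>\<open>real_class\<close> presents the realisation as the class of some sequence;
  reflexivity of \<open>seq_equiv\<close> puts that sequence into its own class.\<close>

lemma ex_realises:
  assumes A: "A \<in> Obj C" and D: "D \<in> Obj C" and d: "\<delta> \<in> carrier (Ext C D A)"
  obtains x B y where "realises C A x B y D \<delta>"
proof -
  obtain s where "s \<in> seqs C A D" "realisation C D A \<delta> = seq_equiv C A D `` {s}"
    using real_class[OF A D d] by (auto elim: quotientE)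
  then have "s \<in> realisation C D A \<delta>" using seq_equiv_refl[OF _ A D] by auto
  then show ?thesis using that A D d unfolding realises_def by (metis prod_cases3)
qed

lemma zero_Ext: "\<lbrakk>A \<in> Obj C; D \<in> Obj C\<rbrakk> \<Longrightarrow> \<zero>\<^bsub>Ext C D A\<^esub> \<in> carrier (Ext C D A)"
  using Ext_module abelian_groupE(2) module.axioms(2) by blast

lemma push_closed:
  "\<lbrakk>A \<in> Obj C; A' \<in> Obj C; D \<in> Obj C; a \<in> carrier (Hom C A A'); \<delta> \<in> carrier (Ext C D A)\<rbrakk>
    \<Longrightarrow> push C a \<delta> \<in> carrier (Ext C D A')"
  using bilinear_map_closed[OF push_bilinear] by blast

lemma pull_closed:
  "\<lbrakk>A \<in> Obj C; D \<in> Obj C; D' \<in> Obj C; c \<in> carrier (Hom C D' D); \<delta> \<in> carrier (Ext C D A)\<rbrakk>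
    \<Longrightarrow> pull C c \<delta> \<in> carrier (Ext C D' A)"
  using bilinear_map_closed[OF pull_bilinear] by blast

lemma push_zero:
  "\<lbrakk>A \<in> Obj C; A' \<in> Obj C; D \<in> Obj C; a \<in> carrier (Hom C A A')\<rbrakk>
    \<Longrightarrow> push C a \<zero>\<^bsub>Ext C D A\<^esub> = \<zero>\<^bsub>Ext C D A'\<^esub>"
  using bilinear_map_zero_right[OF push_bilinear] Ext_module by blast

lemma pull_zero:
  "\<lbrakk>A \<in> Obj C; D \<in> Obj C; D' \<in> Obj C; c \<in> carrier (Hom C D' D)\<rbrakk>
    \<Longrightarrow> pull C c \<zero>\<^bsub>Ext C D A\<^esub> = \<zero>\<^bsub>Ext C D' A\<^esub>"
  using bilinear_map_zero_right[OF pull_bilinear] Ext_module by blast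

text \<open>Comparing a conflation with this trivial one, or with its dual below, turns
  \<open>real_morphism\<close>, \<open>ET3\<close> and \<open>ET3_op\<close> into statements about
  the vanishing of one extension.\<close>

lemma realises_identity_deflation:
  assumes "zero_object C Z" "B \<in> Obj C"
  shows "realises C Z \<zero>\<^bsub>Hom C Z B\<^esub> B (Idm C B) B \<zero>\<^bsub>Ext C B Z\<^esub>"
  using real_zero[OF _ _ biproduct_zero_left] assms unfolding zero_object_def by blast

lemma realises_identity_inflation:
  assumes "zero_object C Z" "B \<in> Obj C"
  shows "realises C B (Idm C B) B \<zero>\<^bsub>Hom C B Z\<^esub> Z \<zero>\<^bsub>Ext C Z B\<^esub>"
  using real_zero[OF _ _ biproduct_zero_right] assms unfolding zero_object_def by blast

text \<open>The identity of \<open>B\<close> and \<open>y\<close> form a commuting square from the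
  trivial conflation on \<open>B\<close>, so by \<open>ET3_op\<close> the pullback is a pushforward
  of zero.\<close>

lemma pull_deflation_eq_zero:
  assumes r: "realises C A x B y D \<delta>"
  shows "pull C y \<delta> = \<zero>\<^bsub>Ext C B A\<^esub>"
proof -
  note o = realises_objects[OF r]
  obtain Z where Z: "zero_object C Z" using ex_zero_object by blast
  then have ZO: "Z \<in> Obj C" unfolding zero_object_def by blast
  obtain a where "a \<in> carrier (Hom C Z A)" "push C a \<zero>\<^bsub>Ext C B Z\<^esub> = pull C y \<delta>"
    using ET3_op[OF realises_identity_deflation[OF Z o(2)] r Id_Hom[OF o(2)] o(5)] by blast
  then show ?thesis using push_zero[OF ZO o(1,2)] by metis
qed

lemma push_inflation_eq_zero:
  assumes r: "realises C A x B y D \<delta>"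
  shows "push C x \<delta> = \<zero>\<^bsub>Ext C D B\<^esub>"
proof -
  note o = realises_objects[OF r]
  obtain Z where Z: "zero_object C Z" using ex_zero_object by blast
  then have ZO: "Z \<in> Obj C" unfolding zero_object_def by blast
  obtain c where "c \<in> carrier (Hom C D Z)" "push C x \<delta> = pull C c \<zero>\<^bsub>Ext C Z B\<^esub>"
    using ET3[OF r realises_identity_inflation[OF Z o(2)] o(4) Id_Hom[OF o(2)]] by blast
  then show ?thesis using pull_zero[OF o(2) ZO o(3)] by metis
qed

text \<open>With zero and \<open>c\<close> on the ends, \<open>real_morphism\<close> maps the
  trivial conflation on \<open>P\<close> to the given one; the middle morphism is the lift. This is
  exactness of Hom(P,B) -> Hom(P,D) -> E(P,A).\<close>

lemma lift_deflation:
  assumes r: "realises C A x B y D \<delta>" and P: "P \<in> Obj C" and c: "c \<in> carrier (Hom C P D)"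
    and 0: "pull C c \<delta> = \<zero>\<^bsub>Ext C P A\<^esub>"
  obtains b where "b \<in> carrier (Hom C P B)" "y \<bullet> b = c"
proof -
  note o = realises_objects[OF r]
  obtain Z where Z: "zero_object C Z" using ex_zero_object by blast
  then have ZO: "Z \<in> Obj C" unfolding zero_object_def by blast
  have "push C \<zero>\<^bsub>Hom C Z A\<^esub> \<zero>\<^bsub>Ext C P Z\<^esub> = pull C c \<delta>"
    using push_zero[OF ZO o(1) P zero_Hom[OF ZO o(1)]] 0 by simp
  from real_morphism[OF realises_identity_deflation[OF Z P] r zero_Hom[OF ZO o(1)] c this]
  show ?thesis using that Id_right[OF P o(3) c] by auto
qed

text \<open>Dual comparison, into the trivial conflation that starts with the identity of
  \<open>I\<close>: exactness of Hom(B,I) -> Hom(A,I) -> E(D,I).\<close>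

lemma extend_inflation:
  assumes r: "realises C A x B y D \<delta>" and I: "I \<in> Obj C" and a: "a \<in> carrier (Hom C A I)"
    and 0: "push C a \<delta> = \<zero>\<^bsub>Ext C D I\<^esub>"
  obtains b where "b \<in> carrier (Hom C B I)" "b \<bullet> x = a"
proof -
  note o = realises_objects[OF r]
  obtain Z where Z: "zero_object C Z" using ex_zero_object by blast
  then have ZO: "Z \<in> Obj C" unfolding zero_object_def by blast
  have "push C a \<delta> = pull C \<zero>\<^bsub>Hom C D Z\<^esub> \<zero>\<^bsub>Ext C Z I\<^esub>"
    using pull_zero[OF I ZO o(3) zero_Hom[OF o(3) ZO]] 0 by simp
  from real_morphism[OF r realises_identity_inflation[OF Z I] a zero_Hom[OF o(3) ZO] this]
  show ?thesis using that Id_left[OF o(1) I a] by auto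
qed

text \<open>In a realisation of \<open>\<theta>\<close>, the vanishing pullback lifts
  \<open>y\<close> to the middle term, and \<open>ET3_op\<close> over the identity of
  \<open>D\<close> yields \<open>a\<close>. This is exactness of Hom(A,M) -> E(D,M) ->
  E(B,M).\<close>

lemma ex_push_of_pull_deflation_eq_zero:
  assumes r: "realises C A x B y D \<delta>" and M: "M \<in> Obj C" and \<theta>: "\<theta> \<in> carrier (Ext C D M)"
    and 0: "pull C y \<theta> = \<zero>\<^bsub>Ext C B M\<^esub>"
  obtains a where "a \<in> carrier (Hom C A M)" "push C a \<delta> = \<theta>"
proof -
  note o = realises_objects[OF r]
  obtain u E v where rE: "realises C M u E v D \<theta>" using ex_realises[OF M o(3) \<theta>] by blast
  obtain b where b: "b \<in> carrier (Hom C B E)" "v \<bullet> b = y"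
    using lift_deflation[OF rE o(2,5) 0] by blast
  have "Idm C D \<bullet> y = v \<bullet> b" using Id_left[OF o(2,3,5)] b(2) by simp
  from ET3_op[OF r rE b(1) Id_Hom[OF o(3)] this]
  show ?thesis using that pull_Id[OF M o(3) \<theta>] by auto
qed

text \<open>Dually, \<open>x\<close> extends to the middle term of a realisation of
  \<open>\<theta>\<close>, and \<open>ET3\<close> applies: exactness of Hom(M,D) -> E(M,A) ->
  E(M,B).\<close>

lemma ex_pull_of_push_inflation_eq_zero:
  assumes r: "realises C A x B y D \<delta>" and M: "M \<in> Obj C" and \<theta>: "\<theta> \<in> carrier (Ext C M A)"
    and 0: "push C x \<theta> = \<zero>\<^bsub>Ext C M B\<^esub>"
  obtains c where "c \<in> carrier (Hom C M D)" "pull C c \<delta> = \<theta>"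
proof -
  note o = realises_objects[OF r]
  obtain u E v where rE: "realises C A u E v M \<theta>" using ex_realises[OF o(1) M \<theta>] by blast
  obtain b where b: "b \<in> carrier (Hom C E B)" "b \<bullet> u = x"
    using extend_inflation[OF rE o(2,4) 0] by blast
  have "b \<bullet> u = x \<bullet> Idm C A" using Id_right[OF o(1,2,4)] b(2) by simp
  from ET3[OF rE r Id_Hom[OF o(1)] b(1) this]
  show ?thesis using that push_Id[OF o(1) M \<theta>] by auto
qed

text \<open>Realise \<open>\<eta>\<close> and compose its deflation with \<open>y\<close> by
  \<open>ET4_op\<close>; the resulting extension \<open>\<epsilon>\<close> of \<open>D\<close> by
  \<open>L\<close> is then pushed to \<open>M\<close>. This is exactness of E(D,M) -> E(B,M) ->
  E(A,M).\<close>

lemma ex_pull_deflation_of_pull_inflation_eq_zero: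
  assumes r: "realises C A x B y D \<delta>" and M: "M \<in> Obj C" and \<eta>: "\<eta> \<in> carrier (Ext C B M)"
    and 0: "pull C x \<eta> = \<zero>\<^bsub>Ext C A M\<^esub>"
  obtains \<theta> where "\<theta> \<in> carrier (Ext C D M)" "pull C y \<theta> = \<eta>"
proof -
  note o = realises_objects[OF r]
  obtain u E v where rE: "realises C M u E v B \<eta>" using ex_realises[OF M o(2) \<eta>] by blast
  obtain L h d e \<epsilon> where L: "realises C L h E (y \<bullet> v) D \<epsilon>"
    and s: "realises C M d L e A (pull C x \<eta>)" and eq: "push C d \<eta> = pull C y \<epsilon>"
    using ET4_op[OF rE r] by blast
  note l = realises_objects[OF L] and so = realises_objects[OF s]
  \<comment> \<open>The conflation from \<open>M\<close> through \<open>L\<close> to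
    \<open>A\<close> realises zero, so \<open>d\<close> has a retraction \<open>t\<close>; the
    witness is \<open>push C t \<epsilon>\<close>.\<close>
  have "push C (Idm C M) (pull C x \<eta>) = \<zero>\<^bsub>Ext C A M\<^esub>"
    using push_Id[OF M o(1) so(6)] 0 by simp
  from extend_inflation[OF s M Id_Hom[OF M] this]
  obtain t where t: "t \<in> carrier (Hom C L M)" "t \<bullet> d = Idm C M" by blast
  have "\<eta> = push C (t \<bullet> d) \<eta>" using push_Id[OF M o(2) \<eta>] t(2) by simp
  also have "\<dots> = push C t (pull C y \<epsilon>)"
    using push_Cmp[OF M l(1) M o(2) \<eta> so(4) t(1)] eq by simp
  also have "\<dots> = pull C y (push C t \<epsilon>)"
    by (rule push_pull[OF l(1) M o(3,2) l(6) t(1) o(5)])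
  finally show ?thesis using that push_closed[OF l(1) M o(3) t(1) l(6)] by simp
qed

text \<open>Dual argument by \<open>ET4\<close>: a section \<open>t\<close> of \<open>e\<close>
  pulls \<open>\<epsilon>\<close> back to the witness. This is exactness of E(M,A) -> E(M,B) ->
  E(M,D).\<close>

lemma ex_push_inflation_of_push_deflation_eq_zero:
  assumes r: "realises C A x B y D \<delta>" and M: "M \<in> Obj C" and \<eta>: "\<eta> \<in> carrier (Ext C M B)"
    and 0: "push C y \<eta> = \<zero>\<^bsub>Ext C M D\<^esub>"
  obtains \<theta> where "\<theta> \<in> carrier (Ext C M A)" "push C x \<theta> = \<eta>"
proof -
  note o = realises_objects[OF r]
  obtain u E v where rE: "realises C B u E v M \<eta>" using ex_realises[OF o(2) M \<eta>] by blast
  obtain L h d e \<epsilon> where L: "realises C A (u \<bullet> x) E h L \<epsilon>"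
    and s: "realises C D d L e M (push C y \<eta>)" and eq: "push C x \<epsilon> = pull C e \<eta>"
    using ET4[OF r rE] by blast
  note l = realises_objects[OF L] and so = realises_objects[OF s]
  have "pull C (Idm C M) (push C y \<eta>) = \<zero>\<^bsub>Ext C M D\<^esub>"
    using pull_Id[OF o(3) M so(6)] 0 by simp
  from lift_deflation[OF s M Id_Hom[OF M] this]
  obtain t where t: "t \<in> carrier (Hom C M L)" "e \<bullet> t = Idm C M" by blast
  have "\<eta> = pull C (e \<bullet> t) \<eta>" using pull_Id[OF o(2) M \<eta>] t(2) by simp
  also have "\<dots> = pull C t (push C x \<epsilon>)"
    using pull_Cmp[OF o(2) M l(3) M \<eta> so(5) t(1)] eq by simp
  also have "\<dots> = push C x (pull C t \<epsilon>)"
    by (rule push_pull[OF o(1,2) l(3) M l(6) o(4) t(1), symmetric])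
  finally show ?thesis using that pull_closed[OF o(1) l(3) M t(1) l(6)] by simp
qed

text \<open>The identity of \<open>P\<close> lifts along the deflation \<open>v\<close> realising
  \<open>\<theta>\<close>, so \<open>\<theta>\<close> is a pullback of
  \<open>pull C v \<theta>\<close>, which vanishes.\<close>

lemma Ext_projective_eq_zero:
  assumes P: "projective C P" and M: "M \<in> Obj C" and \<theta>: "\<theta> \<in> carrier (Ext C P M)"
  shows "\<theta> = \<zero>\<^bsub>Ext C P M\<^esub>"
proof -
  have PO: "P \<in> Obj C" using P unfolding projective_def by blast
  obtain u E v where r: "realises C M u E v P \<theta>" using ex_realises[OF M PO \<theta>] by blast
  note o = realises_objects[OF r]
  have "deflation C E P v" using r unfolding deflation_def conflation_def by blast
  then obtain s where s: "s \<in> carrier (Hom C P E)" "v \<bullet> s = Idm C P"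
    using P Id_Hom[OF PO] unfolding projective_def by blast
  have "\<theta> = pull C s (pull C v \<theta>)"
    using pull_Id[OF M PO \<theta>] s(2) pull_Cmp[OF M PO o(2) PO \<theta> o(5) s(1)] by simp
  then show ?thesis
    using pull_deflation_eq_zero[OF r] pull_zero[OF M o(2) PO s(1)] by simp
qed

lemma Ext_injective_eq_zero:
  assumes I: "injective C I" and M: "M \<in> Obj C" and \<theta>: "\<theta> \<in> carrier (Ext C M I)"
  shows "\<theta> = \<zero>\<^bsub>Ext C M I\<^esub>"
proof -
  have IO: "I \<in> Obj C" using I unfolding injective_def by blast
  obtain u E v where r: "realises C I u E v M \<theta>" using ex_realises[OF IO M \<theta>] by blast
  note o = realises_objects[OF r]
  have "inflation C I E u" using r unfolding inflation_def conflation_def by blast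
  then obtain s where s: "s \<in> carrier (Hom C E I)" "s \<bullet> u = Idm C I"
    using I Id_Hom[OF IO] unfolding injective_def by blast
  have "\<theta> = push C s (push C u \<theta>)"
    using push_Id[OF IO M \<theta>] s(2) push_Cmp[OF IO o(2) IO M \<theta> o(4) s(1)] by simp
  then show ?thesis
    using push_inflation_eq_zero[OF r] push_zero[OF o(2) IO M s(1)] by simp
qed

lemma left_perp_eq_zero:
  "\<lbrakk>Y \<in> left_perp C X; A \<in> X; \<delta> \<in> carrier (Ext C Y A)\<rbrakk> \<Longrightarrow> \<delta> = \<zero>\<^bsub>Ext C Y A\<^esub>"
  unfolding left_perp_def by blast

lemma right_perp_eq_zero:
  "\<lbrakk>Y \<in> right_perp C X; A \<in> X; \<delta> \<in> carrier (Ext C A Y)\<rbrakk> \<Longrightarrow> \<delta> = \<zero>\<^bsub>Ext C A Y\<^esub>"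
  unfolding right_perp_def by blast

section \<open>Approximations\<close>

lemma ex_right_approx_left_perp:
  assumes rig: "rigid C X" and X: "X \<subseteq> Obj C"
    and def: "deflation C P A p" and P: "projective C P"
    and app: "\<And>M. M \<in> Obj C \<Longrightarrow> \<exists>B f. left_approx C X M B f"
  shows "\<exists>B f. right_approx C (left_perp C X) A B f"
proof -
  obtain W w \<delta> where r: "realises C W w P p A \<delta>"
    using def unfolding deflation_def conflation_def by blast
  note o = realises_objects[OF r]
  obtain X0 f where f: "left_approx C X W X0 f" using app[OF o(1)] by blast
  then have X0X: "X0 \<in> X" and fH: "f \<in> carrier (Hom C W X0)" unfolding left_approx_def by auto
  have X0: "X0 \<in> Obj C" using X0X X by blast
  note fd = push_closed[OF o(1) X0 o(3) fH o(6)]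
  \<comment> \<open>Pushout of the syzygy conflation of \<open>A\<close> along the approximation
    \<open>f\<close>; \<open>y\<close> will be the required approximation.\<close>
  obtain x B y where rB: "realises C X0 x B y A (push C f \<delta>)"
    using ex_realises[OF X0 o(3) fd] by blast
  note b = realises_objects[OF rB]
  \<comment> \<open>Diagram chase: rigidity kills \<open>\<eta>\<close> on \<open>X0\<close>, so
    \<open>\<eta>\<close> comes from some \<open>\<theta>\<close> over \<open>A\<close>.
    Projectivity of \<open>P\<close> gives \<open>\<theta>\<close> as a pushforward of
    \<open>\<delta>\<close> along some \<open>g\<close>, and \<open>g\<close> factors through
    \<open>f\<close>. Hence \<open>\<theta>\<close> is a pushforward of
    \<open>push C f \<delta>\<close>, which \<open>y\<close> pulls back to zero.\<close>
  have vanish: "\<eta> = \<zero>\<^bsub>Ext C B X'\<^esub>" if X'X: "X' \<in> X" and \<eta>: "\<eta> \<in> carrier (Ext C B X')" for X' \<eta>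
  proof -
    have X': "X' \<in> Obj C" using X X'X by blast
    have "pull C x \<eta> = \<zero>\<^bsub>Ext C X0 X'\<^esub>"
      using rig X'X right_perp_eq_zero[OF _ X0X pull_closed[OF X' b(2) X0 b(4) \<eta>]]
      unfolding rigid_def by blast
    from ex_pull_deflation_of_pull_inflation_eq_zero[OF rB X' \<eta> this]
    obtain \<theta> where \<theta>: "\<theta> \<in> carrier (Ext C A X')" "pull C y \<theta> = \<eta>" by blast
    have "pull C p \<theta> = \<zero>\<^bsub>Ext C P X'\<^esub>"
      by (rule Ext_projective_eq_zero[OF P X' pull_closed[OF X' o(3,2,5) \<theta>(1)]])
    from ex_push_of_pull_deflation_eq_zero[OF r X' \<theta>(1) this]
    obtain g where g: "g \<in> carrier (Hom C W X')" "push C g \<delta> = \<theta>" by blast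
    obtain h where h: "h \<in> carrier (Hom C X0 X')" "h \<bullet> f = g"
      using f X'X g(1) unfolding left_approx_def by blast
    have "\<eta> = pull C y (push C h (push C f \<delta>))"
      using \<theta>(2) g(2) h(2) push_Cmp[OF o(1) X0 X' o(3,6) fH h(1)] by simp
    also have "\<dots> = push C h (pull C y (push C f \<delta>))"
      by (rule push_pull[OF X0 X' b(3,2) fd h(1) b(5), symmetric])
    also have "\<dots> = \<zero>\<^bsub>Ext C B X'\<^esub>"
      using pull_deflation_eq_zero[OF rB] push_zero[OF X0 X' b(2) h(1)] by simp
    finally show ?thesis .
  qed
  have "B \<in> left_perp C X"
    unfolding left_perp_def using b(2) vanish zero_Ext[OF _ b(2)] X by blast
  moreover have "\<exists>h\<in>carrier (Hom C Y B). y \<bullet> h = g"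
    if Y: "Y \<in> left_perp C X" and g: "g \<in> carrier (Hom C Y A)" for Y g
  proof -
    have YO: "Y \<in> Obj C" using Y unfolding left_perp_def by blast
    \<comment> \<open>This class is the obstruction to lifting \<open>g\<close> along
      \<open>y\<close>; it lives in E(Y,X0).\<close>
    have "pull C g (push C f \<delta>) = \<zero>\<^bsub>Ext C Y X0\<^esub>"
      by (rule left_perp_eq_zero[OF Y X0X pull_closed[OF X0 b(3) YO g fd]])
    from lift_deflation[OF rB YO g this] show ?thesis by blast
  qed
  ultimately show ?thesis using b(5) unfolding right_approx_def by blast
qed

lemma ex_left_approx_right_perp:
  assumes rig: "rigid C X" and X: "X \<subseteq> Obj C"
    and inf: "inflation C A I i" and I: "injective C I"
    and app: "\<And>M. M \<in> Obj C \<Longrightarrow> \<exists>B f. right_approx C X M B f"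
  shows "\<exists>B f. left_approx C (right_perp C X) A B f"
proof -
  obtain W w \<delta> where r: "realises C A i I w W \<delta>"
    using inf unfolding inflation_def conflation_def by blast
  note o = realises_objects[OF r]
  obtain X0 f where f: "right_approx C X W X0 f" using app[OF o(3)] by blast
  then have X0X: "X0 \<in> X" and fH: "f \<in> carrier (Hom C X0 W)" unfolding right_approx_def by auto
  have X0: "X0 \<in> Obj C" using X0X X by blast
  note fd = pull_closed[OF o(1,3) X0 fH o(6)]
  \<comment> \<open>Dual construction: the cosyzygy conflation of \<open>A\<close> is pulled back
    along the approximation \<open>f\<close> of \<open>W\<close>.\<close>
  obtain x B y where rB: "realises C A x B y X0 (pull C f \<delta>)"
    using ex_realises[OF o(1) X0 fd] by blast
  note b = realises_objects[OF rB]
  \<comment> \<open>Dual chase: rigidity makes \<open>\<eta>\<close> a pushforward of some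
    \<open>\<theta>\<close> along \<open>x\<close>, injectivity of \<open>I\<close> makes
    \<open>\<theta>\<close> a pullback of \<open>\<delta>\<close>, and factoring through
    \<open>f\<close> leaves a class that \<open>x\<close> kills.\<close>
  have vanish: "\<eta> = \<zero>\<^bsub>Ext C X' B\<^esub>" if X'X: "X' \<in> X" and \<eta>: "\<eta> \<in> carrier (Ext C X' B)" for X' \<eta>
  proof -
    have X': "X' \<in> Obj C" using X X'X by blast
    have "push C y \<eta> = \<zero>\<^bsub>Ext C X' X0\<^esub>"
      using rig X0X right_perp_eq_zero[OF _ X'X push_closed[OF b(2) X0 X' b(5) \<eta>]]
      unfolding rigid_def by blast
    from ex_push_inflation_of_push_deflation_eq_zero[OF rB X' \<eta> this]
    obtain \<theta> where \<theta>: "\<theta> \<in> carrier (Ext C X' A)" "push C x \<theta> = \<eta>" by blast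
    have "push C i \<theta> = \<zero>\<^bsub>Ext C X' I\<^esub>"
      by (rule Ext_injective_eq_zero[OF I X' push_closed[OF o(1,2) X' o(4) \<theta>(1)]])
    from ex_pull_of_push_inflation_eq_zero[OF r X' \<theta>(1) this]
    obtain g where g: "g \<in> carrier (Hom C X' W)" "pull C g \<delta> = \<theta>" by blast
    obtain h where h: "h \<in> carrier (Hom C X' X0)" "f \<bullet> h = g"
      using f X'X g(1) unfolding right_approx_def by blast
    have "\<eta> = push C x (pull C h (pull C f \<delta>))"
      using \<theta>(2) g(2) h(2) pull_Cmp[OF o(1,3) X0 X' o(6) fH h(1)] by simp
    also have "\<dots> = pull C h (push C x (pull C f \<delta>))"
      by (rule push_pull[OF b(1,2) X0 X' fd b(4) h(1)])
    also have "\<dots> = \<zero>\<^bsub>Ext C X' B\<^esub>"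
      using push_inflation_eq_zero[OF rB] pull_zero[OF b(2) X0 X' h(1)] by simp
    finally show ?thesis .
  qed
  have "B \<in> right_perp C X"
    unfolding right_perp_def using b(2) vanish zero_Ext[OF b(2)] X by blast
  moreover have "\<exists>h\<in>carrier (Hom C B Y). h \<bullet> x = g"
    if Y: "Y \<in> right_perp C X" and g: "g \<in> carrier (Hom C A Y)" for Y g
  proof -
    have YO: "Y \<in> Obj C" using Y unfolding right_perp_def by blast
    have "push C g (pull C f \<delta>) = \<zero>\<^bsub>Ext C X0 Y\<^esub>"
      by (rule right_perp_eq_zero[OF Y X0X push_closed[OF b(1) YO X0 g fd]])
    from extend_inflation[OF rB YO g this] show ?thesis by blast
  qed
  ultimately show ?thesis using b(4) unfolding left_approx_def by blast
qed

end

section \<open>Composition of approximations\<close>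

context linear_category
begin

text \<open>Objects of \<open>T\<close> lie in \<open>Y\<close>, so a morphism from one of them
  factors first through \<open>p\<close>, and the factor then through \<open>q\<close>.\<close>

lemma right_approx_Cmp:
  assumes A: "A \<in> Obj C" and Y: "Y \<subseteq> Obj C" and T: "T \<subseteq> Y"
    and p: "right_approx C Y A B p" and q: "right_approx C T B D q"
  shows "right_approx C T A D (p \<bullet> q)"
proof -
  have B: "B \<in> Obj C" and pH: "p \<in> carrier (Hom C B A)"
    and D: "D \<in> Obj C" and qH: "q \<in> carrier (Hom C D B)"
    using p q Y T unfolding right_approx_def by auto
  have "\<exists>h\<in>carrier (Hom C S D). (p \<bullet> q) \<bullet> h = g"
    if S: "S \<in> T" and g: "g \<in> carrier (Hom C S A)" for S g
  proof -
    have SO: "S \<in> Obj C" using S T Y by blast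
    obtain k where k: "k \<in> carrier (Hom C S B)" "p \<bullet> k = g"
      using p S T g unfolding right_approx_def by blast
    obtain h where h: "h \<in> carrier (Hom C S D)" "q \<bullet> h = k"
      using q S k(1) unfolding right_approx_def by blast
    show ?thesis using Cmp_assoc[OF SO D B A h(1) qH pH] k(2) h by metis
  qed
  then show ?thesis
    using q Cmp_closed[OF D B A qH pH] unfolding right_approx_def by blast
qed

lemma left_approx_Cmp:
  assumes A: "A \<in> Obj C" and Y: "Y \<subseteq> Obj C" and T: "T \<subseteq> Y"
    and p: "left_approx C Y A B p" and q: "left_approx C T B D q"
  shows "left_approx C T A D (q \<bullet> p)"
proof -
  have B: "B \<in> Obj C" and pH: "p \<in> carrier (Hom C A B)"
    and D: "D \<in> Obj C" and qH: "q \<in> carrier (Hom C B D)"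
    using p q Y T unfolding left_approx_def by auto
  have "\<exists>h\<in>carrier (Hom C D S). h \<bullet> (q \<bullet> p) = g"
    if S: "S \<in> T" and g: "g \<in> carrier (Hom C A S)" for S g
  proof -
    have SO: "S \<in> Obj C" using S T Y by blast
    obtain k where k: "k \<in> carrier (Hom C B S)" "k \<bullet> p = g"
      using p S T g unfolding left_approx_def by blast
    obtain h where h: "h \<in> carrier (Hom C D S)" "h \<bullet> q = k"
      using q S k(1) unfolding left_approx_def by blast
    show ?thesis using Cmp_assoc[OF A B D SO pH qH h(1)] k(2) h by metis
  qed
  then show ?thesis
    using q Cmp_closed[OF A B D pH qH] unfolding left_approx_def by blast
qed

text \<open>Approximating first in \<open>Y\<close> and then in \<open>T\<close> carries functorial
  finiteness from \<open>Y\<close> up to the whole category.\<close>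

lemma functorially_finite_trans:
  assumes Y: "functorially_finite C Y" and T: "T \<subseteq> Y"
    and l: "\<And>B. B \<in> Y \<Longrightarrow> \<exists>D f. left_approx C T B D f"
    and r: "\<And>B. B \<in> Y \<Longrightarrow> \<exists>D f. right_approx C T B D f"
  shows "functorially_finite C T"
proof -
  have YO: "Y \<subseteq> Obj C" using Y unfolding functorially_finite_def by blast
  have "(\<exists>D f. left_approx C T A D f) \<and> (\<exists>D f. right_approx C T A D f)" if A: "A \<in> Obj C" for A
  proof
    obtain B p where p: "left_approx C Y A B p"
      using Y A unfolding functorially_finite_def by blast
    then have "B \<in> Y" unfolding left_approx_def by blast
    then show "\<exists>D f. left_approx C T A D f" using l left_approx_Cmp[OF A YO T p] by blast
  next
    obtain B p where p: "right_approx C Y A B p"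
      using Y A unfolding functorially_finite_def by blast
    then have "B \<in> Y" unfolding right_approx_def by blast
    then show "\<exists>D f. right_approx C T A D f" using r right_approx_Cmp[OF A YO T p] by blast
  qed
  then show ?thesis using YO T unfolding functorially_finite_def by blast
qed

end

text \<open>The two constructions give left approximations in \<open>right_perp C X\<close> and
  right approximations in \<open>left_perp C X\<close>; the assumed equality makes them concern one
  subcategory.\<close>

lemma (in frobenius_extriangulated_category) functorially_finite_right_perp:
  assumes "rigid C X" "functorially_finite C X" "right_perp C X = left_perp C X"
  shows "functorially_finite C (right_perp C X)"
proof -
  have X: "X \<subseteq> Obj C" and app: "\<And>M. M \<in> Obj C \<Longrightarrow> \<exists>B f. left_approx C X M B f"
    "\<And>M. M \<in> Obj C \<Longrightarrow> \<exists>B f. right_approx C X M B f"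
    using assms(2) unfolding functorially_finite_def by blast+
  have "right_perp C X \<subseteq> Obj C" unfolding right_perp_def by blast
  moreover have "\<exists>B f. left_approx C (right_perp C X) A B f" if "A \<in> Obj C" for A
    using enough_injectives[OF that] ex_left_approx_right_perp[OF assms(1) X _ _ app(2)] by blast
  moreover have "\<exists>B f. right_approx C (right_perp C X) A B f" if "A \<in> Obj C" for A
    using enough_projectives[OF that] ex_right_approx_left_perp[OF assms(1) X _ _ app(1)]
    unfolding assms(3) by blast
  ultimately show ?thesis unfolding functorially_finite_def by blast
qed

section \<open>Cluster-tilting subcategories of a full subcategory\<close>

text \<open>Restriction keeps morphisms and composition, and an approximation refers to no other
  objects than those of the approximating class and its own source.\<close>

lemma left_approx_full_sub: "left_approx (full_sub C S) = left_approx C"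
  unfolding left_approx_def full_sub_def by simp

lemma right_approx_full_sub: "right_approx (full_sub C S) = right_approx C"
  unfolding right_approx_def full_sub_def by simp

lemma functorially_finite_full_sub:
  "functorially_finite (full_sub C S) T \<longleftrightarrow> T \<subseteq> S \<and>
     (\<forall>A\<in>S. (\<exists>B f. left_approx C T A B f) \<and> (\<exists>B f. right_approx C T A B f))"
  unfolding functorially_finite_def left_approx_full_sub right_approx_full_sub
  by (simp add: full_sub_def)

lemma left_perp_full_sub: "S \<subseteq> Obj C \<Longrightarrow> left_perp (full_sub C S) T = left_perp C T \<inter> S"
  unfolding left_perp_def full_sub_def by auto

lemma right_perp_full_sub: "S \<subseteq> Obj C \<Longrightarrow> right_perp (full_sub C S) T = right_perp C T \<inter> S"
  unfolding right_perp_def full_sub_def by auto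

theorem proposition3p20:
  fixes K :: "('k, 'r) ring_scheme"
    and C :: "('o, 'm, 'k, 'e, 'z) extri_data_scheme"
    and X :: "'o set"
  assumes "frobenius_extriangulated_category K C"
    and "X \<subseteq> Obj C"
    and "rigid C X"
    and "functorially_finite C X"
    and "right_perp C X = left_perp C X"
  shows "{T. cluster_tilting (full_sub C (right_perp C X)) T} = {T. cluster_tilting C T \<and> X \<subseteq> T}"
proof -
  interpret frobenius_extriangulated_category K C by (rule assms(1))
  define Y where "Y = right_perp C X"
  have Y: "Y \<subseteq> Obj C" unfolding Y_def right_perp_def by blast
  have XY: "X \<subseteq> Y" using assms(3) unfolding rigid_def Y_def .
  have Yl: "Y = left_perp C X" using assms(5) Y_def by simp
  have ff: "functorially_finite C Y"
    unfolding Y_def by (rule functorially_finite_right_perp[OF assms(3-5)])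
  note sub = functorially_finite_full_sub left_perp_full_sub[OF Y] right_perp_full_sub[OF Y]
  have "cluster_tilting C T \<and> X \<subseteq> T" if ct: "cluster_tilting (full_sub C Y) T" for T
  proof -
    have TY: "T \<subseteq> Y" and app: "\<And>A. A \<in> Y \<Longrightarrow> \<exists>B f. left_approx C T A B f"
      "\<And>A. A \<in> Y \<Longrightarrow> \<exists>B f. right_approx C T A B f"
      and lp: "left_perp C T \<inter> Y = T" and rp: "T = right_perp C T \<inter> Y"
      using ct unfolding cluster_tilting_def sub by blast+
    \<comment> \<open>\<open>T \<subseteq> Y\<close> says that E(X,T) vanishes. As \<open>X\<close>
      also lies in \<open>Y\<close> by rigidity, the cluster-tilting condition inside
      \<open>Y\<close> forces \<open>X \<subseteq> T\<close>.\<close>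
    have "X \<subseteq> left_perp C T"
      using TY XY Y unfolding Y_def left_perp_def right_perp_def by blast
    then have XT: "X \<subseteq> T" using lp XY by blast
    \<comment> \<open>Perpendiculars reverse inclusions, and both perpendiculars of \<open>X\<close>
      equal \<open>Y\<close>; hence intersecting those of \<open>T\<close> with \<open>Y\<close>
      changes nothing.\<close>
    have "left_perp C T \<subseteq> Y" using XT unfolding Yl left_perp_def by blast
    moreover have "right_perp C T \<subseteq> Y" using XT unfolding Y_def right_perp_def by blast
    moreover have "functorially_finite C T" by (rule functorially_finite_trans[OF ff TY app])
    ultimately show ?thesis using lp rp XT unfolding cluster_tilting_def by blast
  qed
  moreover have "cluster_tilting (full_sub C Y) T" if ct: "cluster_tilting C T" and XT: "X \<subseteq> T" for T
  proof -
    have rp: "T = right_perp C T" and lp: "left_perp C T = T" and fT: "functorially_finite C T"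
      using ct unfolding cluster_tilting_def by simp_all
    \<comment> \<open>Again by reversal of inclusions: \<open>T\<close> is its own right
      perpendicular, which lies in that of \<open>X\<close>.\<close>
    have TY: "T \<subseteq> Y" using rp XT unfolding Y_def right_perp_def by blast
    then have "functorially_finite (full_sub C Y) T"
      using fT[unfolded functorially_finite_def] Y unfolding sub(1) by (meson subsetD)
    moreover have "left_perp C T \<inter> Y = T" "T = right_perp C T \<inter> Y"
      using lp rp TY by (simp_all add: Int_absorb2)
    ultimately show ?thesis unfolding cluster_tilting_def sub(2,3) by blast
  qed
  ultimately show ?thesis unfolding Y_def by blast
qed

end
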